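(* Let $u\in V\cap H^s(\Omega)$ be the solution of $a(u,w)=l(w)$ for all $w\in W$, and let $(u_h,z_h)\in V_h\times W_h$ be the solution of $$a(u_h,w_h)-s_W(z_h,w_h)=l(w_h),\qquad a(v_h,z_h)+s_V(u_h,v_h)=s_V(u,v_h)\qquad\text{for all }(v_h,w_h)\in V_h\times W_h.$$ Assume that: (i) $s_V$ and $s_W$ are symmetric and positive semi-definite and define semi-norms $|\cdot|_{s_V}=s_V(\cdot,\cdot)^{1/2}$ and $|\cdot|_{s_W}=s_W(\cdot,\cdot)^{1/2}$ on $H^s(\Omega)+V_h$ and $H^s(\Omega)+W_h$ respectively; (ii) $a(v-i_Vv,w_h)\le \|v-i_Vv\|_{*,V}\,|w_h|_{s_W}$ for all $v\in V$, $w_h\in W_h$; (iii) $a(u-u_h,w-i_Ww)\le \delta_l(h)\|w\|_W+\|w-i_Ww\|_{*,W}\,|u-u_h|_{s_V}$ for all $w\in W$; (iv) $|v-i_Vv|_{s_V}+\|v-i_Vv\|_{*,V}\le C_V(v)h^t$ for all sufficiently smooth $v\in V$ (i.e. all $v\in V^{\mathrm{sm}}$, see context), where $t>0$; (v) $\|w-i_Ww\|_{*,W}+|i_Ww|_{s_W}\le C_W\|w\|_W$ for all $w\in W$, for some constant $C_W>0$. Assume moreover that the problem has the following continuous dependence property for the functional $j:V\to\mathbb{R}$, the function $\Xi$ and some $\epsilon_0>0$: whenever $0<\epsilon<\epsilon_0$, $\tilde l:W\to\mathbb{R}$ is linear with $\|\tilde l\|_{W'}\le\epsilon$, and $\tilde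 u\in V$ satisfies $a(\tilde u,w)=\tilde l(w)$ for all $w\in W$, then $|j(\tilde u)|\le\Xi(\epsilon)$. Define the a posteriori quantity $$\eta(u_h,z_h):=\delta_l(h)+C_W\big(|u-u_h|_{s_V}+|z_h|_{s_W}\big).$$ Then, provided $\eta(u_h,z_h)<\epsilon_0$, $$|j(u-u_h)|\le \Xi(\eta(u_h,z_h)).$$ Furthermore, if $u$ is sufficiently smooth (i.e. $u\in V^{\mathrm{sm}}$), then $$\eta(u_h,z_h)\le \delta_l(h)+(1+\sqrt2)\,C_W\,C_V(u)\,h^t.$$
   Context: Setting. $\Omega\subset\mathbb{R}^d$ is a convex polygonal (polyhedral) domain; $V$ and $W$ are real normed spaces of functions on $\Omega$ (model case: subspaces of $H^1(\Omega)$ with vanishing trace on parts of $\partial\Omega$), $\|\cdot\|_W$ is the norm of $W$; $a:V\times W\to\mathbb{R}$ is a bilinear form and $l:W\to\mathbb{R}$ a linear form. It is assumed that $l$ is such that the problem "find $u\in V$ with $a(u,w)=l(w)$ for all $w\in W$" has a unique solution $u$; no coercivity or inf-sup stability of $a$ is assumed, nor solvability for other right-hand sides. The dual norm is $\|l\|_{W'}=\sup_{w\in W,\ \|w\|_W=1}|l(w)|$. The function $\Xi:\mathbb{R}^+\to\mathbb{R}^+$ is continuous and monotone increasing with $\lim_{x\to0^+}\Xi(x)=0$ (convention: $\Xi(0)=0$). Discretization. $\mathcal{K}_h$ is a shape regular, conforming subdivision of $\Omega$ into non-overlapping simplices with mesh parameter $h=\max_{\kappa\in\mathcal K_h}\mathrm{diam}(\kappa)$;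 $X_h^1$ is the space of continuous piecewise affine functions on $\mathcal{K}_h$; $V_h=V\cap X_h^1$ and $W_h=W\cap X_h^1$. Stabilization and interpolation. $s_V$ and $s_W$ are symmetric positive semi-definite bilinear forms on $V_h$ and $W_h$, which for some $s\ge1$ are also defined on $H^s(\Omega)+V_h$ and $H^s(\Omega)+W_h$ respectively, and the quantity $s_V(u,v_h)$, with $u$ the exact solution, is assumed explicitly known. $i_V:V\to V_h$ and $i_W:W\to W_h$ are interpolation operators and $\|\cdot\|_{*,V}$, $\|\cdot\|_{*,W}$ are norms on $V$ and $W$ respectively. $\delta_l(h)\ge0$ is a number depending on the interpolant $i_W$ and on the data of the problem. "Sufficiently smooth" refers to a class $V^{\mathrm{sm}}\subset V\cap H^s(\Omega)$ of functions $v$ for which the approximation bound (iv) holds with a finite factor $C_V(v)>0$ (typically depending on some Sobolev norm of $v$). *)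

theory Defs
  imports "HOL-Analysis.Analysis"
begin

section \<open>Functions modulo equality almost everywhere\<close>

text \<open>Elements of Sobolev-type spaces are classes of functions that agree almost everywhere.
  A function on an open set \<open>\<Omega>\<close> is represented by its extension by zero to the whole space, so
  that all function spaces on \<open>\<Omega>\<close> are subspaces of one vector space.\<close>

quotient_type (overloaded) 'a aefun =
  "'a::euclidean_space \<Rightarrow> real" / "\<lambda>f g. AE x in lborel. f x = g x"
proof (rule equivpI)
  show "reflp (\<lambda>f g. AE x in lborel. f x = (g x :: real))"
    by (simp add: reflp_def)
  show "symp (\<lambda>f g. AE x in lborel. f x = (g x :: real))"
    by (rule sympI) (auto elim: eventually_mono)
  show "transp (\<lambda>f g. AE x in lborel. f x = (g x :: real))"
    by (rule transpI) (auto elim: eventually_elim2)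
qed

lift_definition ae_class :: "('a::euclidean_space \<Rightarrow> real) \<Rightarrow> 'a aefun" is "\<lambda>f. f" .

instantiation aefun :: (euclidean_space) real_vector
begin

lift_definition zero_aefun :: "'a aefun" is "\<lambda>x. 0" .

lift_definition plus_aefun :: "'a aefun \<Rightarrow> 'a aefun \<Rightarrow> 'a aefun" is "\<lambda>f g x. f x + g x"
  by (auto elim: eventually_elim2)

lift_definition minus_aefun :: "'a aefun \<Rightarrow> 'a aefun \<Rightarrow> 'a aefun" is "\<lambda>f g x. f x - g x"
  by (auto elim: eventually_elim2)

lift_definition uminus_aefun :: "'a aefun \<Rightarrow> 'a aefun" is "\<lambda>f x. - f x"
  by (auto elim: eventually_mono)

lift_definition scaleR_aefun :: "real \<Rightarrow> 'a aefun \<Rightarrow> 'a aefun" is "\<lambda>c f x. c * f x"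
  by (auto elim: eventually_mono)

instance
  by standard (transfer; simp add: algebra_simps)+

end

definition functions_on :: "'a::euclidean_space set \<Rightarrow> 'a aefun set" where
  "functions_on \<Omega> = {ae_class f | f. \<forall>x. x \<notin> \<Omega> \<longrightarrow> f x = 0}"


section \<open>Norms and forms on subspaces\<close>

definition seminorm_on :: "'v::real_vector set \<Rightarrow> ('v \<Rightarrow> real) \<Rightarrow> bool" where
  "seminorm_on S N \<longleftrightarrow>
     (\<forall>v\<in>S. 0 \<le> N v) \<and> (\<forall>c. \<forall>v\<in>S. N (c *\<^sub>R v) = \<bar>c\<bar> * N v) \<and>
     (\<forall>v\<in>S. \<forall>w\<in>S. N (v + w) \<le> N v + N w)"

definition norm_on :: "'v::real_vector set \<Rightarrow> ('v \<Rightarrow> real) \<Rightarrow> bool" where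
  "norm_on S N \<longleftrightarrow> seminorm_on S N \<and> (\<forall>v\<in>S. N v = 0 \<longrightarrow> v = 0)"

definition normed_function_space ::
    "'a::euclidean_space set \<Rightarrow> 'a aefun set \<Rightarrow> ('a aefun \<Rightarrow> real) \<Rightarrow> bool" where
  "normed_function_space \<Omega> V N \<longleftrightarrow> V \<subseteq> functions_on \<Omega> \<and> subspace V \<and> norm_on V N"

definition linear_form_on :: "'v::real_vector set \<Rightarrow> ('v \<Rightarrow> real) \<Rightarrow> bool" where
  "linear_form_on S l \<longleftrightarrow>
     (\<forall>v\<in>S. \<forall>w\<in>S. l (v + w) = l v + l w) \<and> (\<forall>c. \<forall>v\<in>S. l (c *\<^sub>R v) = c * l v)"

definition bilinear_form_on ::
    "'v::real_vector set \<Rightarrow> 'w::real_vector set \<Rightarrow> ('v \<Rightarrow> 'w \<Rightarrow> real) \<Rightarrow> bool" where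
  "bilinear_form_on S T a \<longleftrightarrow>
     (\<forall>v\<in>S. linear_form_on T (a v)) \<and> (\<forall>w\<in>T. linear_form_on S (\<lambda>v. a v w))"

definition sym_psd_form_on :: "'v::real_vector set \<Rightarrow> ('v \<Rightarrow> 'v \<Rightarrow> real) \<Rightarrow> bool" where
  "sym_psd_form_on S s \<longleftrightarrow>
     bilinear_form_on S S s \<and> (\<forall>v\<in>S. \<forall>w\<in>S. s v w = s w v) \<and> (\<forall>v\<in>S. 0 \<le> s v v)"

definition form_seminorm :: "('v \<Rightarrow> 'v \<Rightarrow> real) \<Rightarrow> 'v \<Rightarrow> real" where
  "form_seminorm s v = sqrt (s v v)"

text \<open>The values are extended nonnegative reals: the dual norm of an unbounded form is \<open>\<infinity>\<close>, and
  that of the zero form on the trivial space (an empty supremum) is \<open>0\<close>.\<close>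

definition dual_norm :: "'w set \<Rightarrow> ('w \<Rightarrow> real) \<Rightarrow> ('w \<Rightarrow> real) \<Rightarrow> ennreal" where
  "dual_norm W N l = (SUP w\<in>{w\<in>W. N w = 1}. ennreal \<bar>l w\<bar>)"


section \<open>Sobolev spaces\<close>

text \<open>A list of coordinate directions plays the role of a multi-index; the order of the entries
  is irrelevant for smooth functions.\<close>

primrec partial_derivs :: "'a list \<Rightarrow> ('a::euclidean_space \<Rightarrow> real) \<Rightarrow> 'a \<Rightarrow> real" where
  "partial_derivs [] f = f"
| "partial_derivs (b # bs) f = (\<lambda>x. frechet_derivative (partial_derivs bs f) (at x) b)"

definition smooth_fun :: "('a::euclidean_space \<Rightarrow> real) \<Rightarrow> bool" where
  "smooth_fun f \<longleftrightarrow>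
     (\<forall>bs. set bs \<subseteq> Basis \<longrightarrow> (\<forall>x. partial_derivs bs f differentiable (at x)))"

definition test_functions :: "'a::euclidean_space set \<Rightarrow> ('a \<Rightarrow> real) set" where
  "test_functions \<Omega> =
     {\<phi>. smooth_fun \<phi> \<and> compact (closure {x. \<phi> x \<noteq> 0}) \<and> closure {x. \<phi> x \<noteq> 0} \<subseteq> \<Omega>}"

definition L2_functions :: "'a::euclidean_space set \<Rightarrow> ('a \<Rightarrow> real) set" where
  "L2_functions \<Omega> =
     {f \<in> borel_measurable borel. (\<forall>x. x \<notin> \<Omega> \<longrightarrow> f x = 0) \<and> integrable lborel (\<lambda>x. (f x)\<^sup>2)}"

definition weak_derivative ::
    "'a::euclidean_space set \<Rightarrow> 'a list \<Rightarrow> ('a \<Rightarrow> real) \<Rightarrow> ('a \<Rightarrow> real) \<Rightarrow> bool" where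
  "weak_derivative \<Omega> bs f g \<longleftrightarrow>
     (\<forall>\<phi>\<in>test_functions \<Omega>.
        (LINT x|lborel. f x * partial_derivs bs \<phi> x) =
        (-1) ^ length bs * (LINT x|lborel. g x * \<phi> x))"

definition slobodeckij_energy ::
    "'a::euclidean_space set \<Rightarrow> real \<Rightarrow> ('a \<Rightarrow> real) \<Rightarrow> ennreal" where
  "slobodeckij_energy \<Omega> \<theta> g =
     (\<integral>\<^sup>+x\<in>\<Omega>. (\<integral>\<^sup>+y\<in>\<Omega>.
        ennreal ((g x - g y)\<^sup>2 / dist x y powr (real DIM('a) + 2 * \<theta>)) \<partial>lborel) \<partial>lborel)"

text \<open>\<open>H\<^sup>s(\<Omega>)\<close> for real \<open>s \<ge> 0\<close>; for fractional \<open>s\<close> this is the Sobolev--Slobodeckij space,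
  with the additional condition on the weak derivatives of the highest order \<open>\<lfloor>s\<rfloor>\<close>.\<close>

definition sobolev :: "'a::euclidean_space set \<Rightarrow> real \<Rightarrow> 'a aefun set" where
  "sobolev \<Omega> s =
     {ae_class f | f. f \<in> L2_functions \<Omega> \<and>
        (\<forall>bs. set bs \<subseteq> Basis \<and> length bs \<le> nat \<lfloor>s\<rfloor> \<longrightarrow>
           (\<exists>g\<in>L2_functions \<Omega>. weak_derivative \<Omega> bs f g \<and>
              (length bs = nat \<lfloor>s\<rfloor> \<and> frac s > 0 \<longrightarrow> slobodeckij_energy \<Omega> (frac s) g < \<infinity>)))}"


section \<open>Domains, meshes and piecewise affine functions\<close>

definition convex_polyhedral_domain :: "'a::euclidean_space set \<Rightarrow> bool" where
  "convex_polyhedral_domain \<Omega> \<longleftrightarrow>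
     open \<Omega> \<and> \<Omega> \<noteq> {} \<and> convex \<Omega> \<and> polytope (closure \<Omega>)"

text \<open>Conformity is part of \<^const>\<open>triangulation\<close>: any two cells intersect in a common (possibly
  empty) face. As all cells have full dimension, distinct ones do not overlap.\<close>

definition simplicial_mesh :: "'a::euclidean_space set \<Rightarrow> 'a set set \<Rightarrow> bool" where
  "simplicial_mesh \<Omega> K \<longleftrightarrow>
     triangulation K \<and> (\<forall>\<kappa>\<in>K. int DIM('a) simplex \<kappa>) \<and> \<Union>K = closure \<Omega>"

text \<open>Each cell contains a ball whose radius is at least its diameter divided by \<open>\<sigma>\<close>.\<close>

definition shape_regular :: "real \<Rightarrow> 'a::euclidean_space set set \<Rightarrow> bool" where
  "shape_regular \<sigma> K \<longleftrightarrow>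
     (\<forall>\<kappa>\<in>K. \<exists>x r. r > 0 \<and> ball x r \<subseteq> \<kappa> \<and> diameter \<kappa> \<le> \<sigma> * r)"

definition mesh_size :: "'a::euclidean_space set set \<Rightarrow> real" where
  "mesh_size K = Max (diameter ` K)"

definition P1_space :: "'a::euclidean_space set \<Rightarrow> 'a set set \<Rightarrow> 'a aefun set" where
  "P1_space \<Omega> K =
     {ae_class (\<lambda>x. if x \<in> \<Omega> then f x else 0) | f.
        continuous_on (closure \<Omega>) f \<and> (\<forall>\<kappa>\<in>K. \<exists>p c. \<forall>x\<in>\<kappa>. f x = p \<bullet> x + c)}"


section \<open>The error estimator\<close>

definition estimator ::
    "real \<Rightarrow> real \<Rightarrow> ('v::real_vector \<Rightarrow> 'v \<Rightarrow> real) \<Rightarrow> ('w \<Rightarrow> 'w \<Rightarrow> real) \<Rightarrow>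
     'v \<Rightarrow> 'v \<Rightarrow> 'w \<Rightarrow> real" where
  "estimator \<delta> C sV sW u uh zh = \<delta> + C * (form_seminorm sV (u - uh) + form_seminorm sW zh)"

end

theory Submission
  imports Defs
begin

text \<open>The error \<open>e = u - uh\<close> solves the continuous problem with the residual
  \<open>w \<mapsto> a(e, w) = a(e, w - iW w) - sW(zh, iW w)\<close> as right-hand side. By (iii), (v) and
  Cauchy--Schwarz the dual norm of this residual is at most \<open>\<eta>\<close>, so continuous dependence applies.
  For the a priori bound put \<open>\<xi> = iV u - uh\<close>. Testing the two discrete equations with \<open>zh\<close> and
  \<open>\<xi>\<close> gives \<open>|\<xi>|\<^sup>2 + |zh|\<^sup>2 = -a(u - iV u, zh) - sV(u - iV u, \<xi>)\<close>, which by (ii) controls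
  \<open>|\<xi>| + |zh|\<close> by \<open>sqrt 2\<close> times the interpolation error; the remaining \<open>1\<close> in
  \<open>1 + sqrt 2\<close> is the triangle inequality \<open>|e| \<le> |u - iV u| + |\<xi>|\<close>.\<close>

section \<open>Piecewise affine and Sobolev function classes\<close>

lemma ae_class_zero: "ae_class (\<lambda>x. 0) = 0"
  by transfer simp

lemma ae_class_add: "ae_class f + ae_class g = ae_class (\<lambda>x. f x + g x)"
  by transfer simp

lemma ae_class_scaleR: "c *\<^sub>R ae_class f = ae_class (\<lambda>x. c * f x)"
  by transfer simp

text \<open>Makes \<open>Vh\<close> and \<open>Wh\<close> subspaces, so that
  \<open>iV u - uh\<close>, \<open>- zh\<close> and \<open>zh - iW w\<close> are again discrete
  functions.\<close>

lemma subspace_P1_space: "subspace (P1_space \<Omega> K)"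
proof (rule subspaceI)
  show "0 \<in> P1_space \<Omega> K"
    unfolding P1_space_def mem_Collect_eq
    by (rule exI[of _ "\<lambda>x. 0"]) (auto simp: ae_class_zero intro!: exI[of _ 0])
next
  fix x y assume "x \<in> P1_space \<Omega> K" "y \<in> P1_space \<Omega> K"
  then obtain f g
    where x: "x = ae_class (\<lambda>x. if x \<in> \<Omega> then f x else 0)"
      and y: "y = ae_class (\<lambda>x. if x \<in> \<Omega> then g x else 0)"
      and cont: "continuous_on (closure \<Omega>) f" "continuous_on (closure \<Omega>) g"
      and f: "\<And>\<kappa>. \<kappa> \<in> K \<Longrightarrow> \<exists>p c. \<forall>x\<in>\<kappa>. f x = p \<bullet> x + c"
      and g: "\<And>\<kappa>. \<kappa> \<in> K \<Longrightarrow> \<exists>p c. \<forall>x\<in>\<kappa>. g x = p \<bullet> x + c"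
    unfolding P1_space_def by blast
  have "\<exists>p c. \<forall>x\<in>\<kappa>. f x + g x = p \<bullet> x + c" if "\<kappa> \<in> K" for \<kappa>
  proof -
    obtain p c q d where "\<forall>x\<in>\<kappa>. f x = p \<bullet> x + c" "\<forall>x\<in>\<kappa>. g x = q \<bullet> x + d"
      using f[OF \<open>\<kappa> \<in> K\<close>] g[OF \<open>\<kappa> \<in> K\<close>] by blast
    then have "\<forall>x\<in>\<kappa>. f x + g x = (p + q) \<bullet> x + (c + d)"
      by (simp add: inner_add_left)
    then show ?thesis by blast
  qed
  moreover have "x + y = ae_class (\<lambda>x. if x \<in> \<Omega> then f x + g x else 0)"
    unfolding x y ae_class_add by (rule arg_cong[of _ _ ae_class]) auto
  ultimately show "x + y \<in> P1_space \<Omega> K"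
    unfolding P1_space_def mem_Collect_eq using cont
    by (intro exI[of _ "\<lambda>x. f x + g x"]) (simp add: continuous_on_add)
next
  fix r x assume "x \<in> P1_space \<Omega> K"
  then obtain f
    where x: "x = ae_class (\<lambda>x. if x \<in> \<Omega> then f x else 0)"
      and cont: "continuous_on (closure \<Omega>) f"
      and f: "\<And>\<kappa>. \<kappa> \<in> K \<Longrightarrow> \<exists>p c. \<forall>x\<in>\<kappa>. f x = p \<bullet> x + c"
    unfolding P1_space_def by blast
  have "\<exists>p c. \<forall>x\<in>\<kappa>. r * f x = p \<bullet> x + c" if "\<kappa> \<in> K" for \<kappa>
  proof -
    obtain p c where "\<forall>x\<in>\<kappa>. f x = p \<bullet> x + c"
      using f[OF \<open>\<kappa> \<in> K\<close>] by blast
    then have "\<forall>x\<in>\<kappa>. r * f x = (r *\<^sub>R p) \<bullet> x + r * c"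
      by (simp add: algebra_simps)
    then show ?thesis by blast
  qed
  moreover have "r *\<^sub>R x = ae_class (\<lambda>x. if x \<in> \<Omega> then r * f x else 0)"
    unfolding x ae_class_scaleR by (rule arg_cong[of _ _ ae_class]) auto
  ultimately show "r *\<^sub>R x \<in> P1_space \<Omega> K"
    unfolding P1_space_def mem_Collect_eq using cont
    by (intro exI[of _ "\<lambda>x. r * f x"]) (simp add: continuous_on_mult_left)
qed

text \<open>The zero function is its own weak derivative of every order and has zero energy. Writing
  \<open>v = 0 + v\<close> then places \<open>Vh\<close> and \<open>Wh\<close> inside the set sums
  on which (i) is assumed.\<close>

lemma zero_in_sobolev: "0 \<in> sobolev \<Omega> s"
proof -
  have "(\<lambda>x. 0) \<in> L2_functions \<Omega>"
    by (simp add: L2_functions_def)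
  moreover have "weak_derivative \<Omega> bs (\<lambda>x. 0) (\<lambda>x. 0)" for bs
    by (simp add: weak_derivative_def)
  moreover have "slobodeckij_energy \<Omega> \<theta> (\<lambda>x. 0) < \<infinity>" for \<theta>
    by (simp add: slobodeckij_energy_def)
  ultimately have "ae_class (\<lambda>x. 0) \<in> sobolev \<Omega> s"
    unfolding sobolev_def by blast
  then show ?thesis
    by (simp add: ae_class_zero)
qed

section \<open>Calculus of forms and seminorms on sets\<close>

lemma linear_form_on_add:
  "linear_form_on S l \<Longrightarrow> v \<in> S \<Longrightarrow> w \<in> S \<Longrightarrow> l (v + w) = l v + l w"
  by (simp add: linear_form_on_def)

lemma linear_form_on_uminus:
  assumes "linear_form_on S l" "v \<in> S"
  shows "l (- v) = - l v"
proof -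
  have "l ((- 1) *\<^sub>R v) = (- 1) * l v"
    using assms unfolding linear_form_on_def by blast
  then show ?thesis by simp
qed

lemma linear_form_on_diff:
  assumes "linear_form_on S l" "subspace S" "v \<in> S" "w \<in> S"
  shows "l (v - w) = l v - l w"
  using linear_form_on_add[OF assms(1), of v "- w"] linear_form_on_uminus[OF assms(1,4)] assms
  by (simp add: subspace_neg)

lemma bilinear_form_onD:
  assumes "bilinear_form_on S T a"
  shows "v \<in> S \<Longrightarrow> linear_form_on T (a v)"
    and "w \<in> T \<Longrightarrow> linear_form_on S (\<lambda>v. a v w)"
  using assms by (auto simp: bilinear_form_on_def)

lemma seminorm_onD:
  assumes "seminorm_on S N"
  shows "v \<in> S \<Longrightarrow> 0 \<le> N v"
    and "v \<in> S \<Longrightarrow> w \<in> S \<Longrightarrow> N (v + w) \<le> N v + N w"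
  using assms by (auto simp: seminorm_on_def)

lemma seminorm_on_uminus:
  assumes "seminorm_on S N" "v \<in> S"
  shows "N (- v) = N v"
proof -
  have "N ((- 1) *\<^sub>R v) = \<bar>- 1\<bar> * N v"
    using assms unfolding seminorm_on_def by blast
  then show ?thesis by simp
qed

lemma form_seminorm_square:
  "sym_psd_form_on S s \<Longrightarrow> v \<in> S \<Longrightarrow> (form_seminorm s v)\<^sup>2 = s v v"
  by (simp add: sym_psd_form_on_def form_seminorm_def)

text \<open>Since \<open>S\<close> need not be a subspace, the usual discriminant argument is unavailable; expanding
  the squared triangle inequality only needs \<open>x + y \<in> S\<close>.\<close>

lemma sym_psd_form_on_Cauchy_Schwarz:
  assumes s: "sym_psd_form_on S s" and N: "seminorm_on S (form_seminorm s)"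
    and S: "x \<in> S" "y \<in> S" "x + y \<in> S"
  shows "s x y \<le> form_seminorm s x * form_seminorm s y"
proof -
  have b: "bilinear_form_on S S s" and sym: "s y x = s x y"
    using s S by (auto simp: sym_psd_form_on_def)
  have "s (x + y) (x + y) = s x x + 2 * s x y + s y y"
    using linear_form_on_add[OF bilinear_form_onD(2)[OF b S(3)] S(1,2)]
      linear_form_on_add[OF bilinear_form_onD(1)[OF b S(1)] S(1,2)]
      linear_form_on_add[OF bilinear_form_onD(1)[OF b S(2)] S(1,2)] sym
    by simp
  moreover have "(form_seminorm s (x + y))\<^sup>2 \<le> (form_seminorm s x + form_seminorm s y)\<^sup>2"
    using seminorm_onD[OF N] S by (intro power_mono) auto
  ultimately show ?thesis
    using form_seminorm_square[OF s] S by (simp add: power2_sum)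
qed

text \<open>Put \<open>R = sqrt (x^2 + y^2)\<close>. Both \<open>x\<close> and \<open>y\<close> are
  at most \<open>R\<close>, so the hypothesis gives \<open>R^2 \<le> (p + q) * R\<close> and thus
  \<open>R \<le> p + q\<close>; finally \<open>x + y \<le> sqrt 2 * R\<close>.\<close>

lemma sum_le_sqrt2_of_squares_le:
  fixes p q x y :: real
  assumes nonneg: "0 \<le> p" "0 \<le> q" "0 \<le> x" "0 \<le> y"
    and le: "x\<^sup>2 + y\<^sup>2 \<le> p * x + q * y"
  shows "x + y \<le> sqrt 2 * (p + q)"
proof -
  have "p * x + q * y \<le> (p + q) * sqrt (x\<^sup>2 + y\<^sup>2)"
    using nonneg by (simp add: distrib_right add_mono mult_left_mono real_le_rsqrt)
  with le have "sqrt (x\<^sup>2 + y\<^sup>2) * sqrt (x\<^sup>2 + y\<^sup>2) \<le> (p + q) * sqrt (x\<^sup>2 + y\<^sup>2)"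
    by simp
  moreover have "0 \<le> sqrt (x\<^sup>2 + y\<^sup>2)" by simp
  \<comment> \<open>Cancelling the common factor requires it to be positive; if it vanishes, the
    claim is \<open>0 \<le> p + q\<close>.\<close>
  ultimately have r: "sqrt (x\<^sup>2 + y\<^sup>2) \<le> p + q"
    using add_nonneg_nonneg[OF nonneg(1,2)] unfolding mult_le_cancel_right by linarith
  have "(x + y)\<^sup>2 \<le> 2 * (x\<^sup>2 + y\<^sup>2)"
    using zero_le_power2[of "x - y"] by (simp add: power2_sum power2_diff)
  then have "x + y \<le> sqrt (2 * (x\<^sup>2 + y\<^sup>2))"
    by (rule real_le_rsqrt)
  also have "\<dots> \<le> sqrt 2 * (p + q)"
    unfolding real_sqrt_mult using r by (intro mult_left_mono) auto
  finally show ?thesis .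
qed

text \<open>A one-sided bound suffices because it can be applied to \<open>- w\<close>, which has
  the same norm. This matches (iii), which is stated without absolute values.\<close>

lemma dual_norm_le:
  assumes "linear_form_on W l" "norm_on W N" "subspace W" "0 \<le> \<epsilon>"
    and le: "\<And>w. w \<in> W \<Longrightarrow> l w \<le> \<epsilon> * N w"
  shows "dual_norm W N l \<le> ennreal \<epsilon>"
  unfolding dual_norm_def
proof (rule SUP_least)
  fix w assume w: "w \<in> {w \<in> W. N w = 1}"
  have "- l w \<le> \<epsilon> * N (- w)"
    using le[of "- w"] linear_form_on_uminus[OF assms(1)] w \<open>subspace W\<close>
    by (simp add: subspace_neg)
  then have "\<bar>l w\<bar> \<le> \<epsilon>"
    using le[of w] seminorm_on_uminus[of W N w] assms(2) w by (auto simp: norm_on_def)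
  then show "ennreal \<bar>l w\<bar> \<le> ennreal \<epsilon>"
    by (rule ennreal_leI)
qed

theorem theorem4p2:
  fixes \<Omega> :: "(real ^ 'd::finite) set"
    and V W Vh Wh Vsm :: "(real ^ 'd) aefun set"
    and normV normW starV starW :: "(real ^ 'd) aefun \<Rightarrow> real"
    and a sV sW :: "(real ^ 'd) aefun \<Rightarrow> (real ^ 'd) aefun \<Rightarrow> real"
    and l j C\<^sub>V :: "(real ^ 'd) aefun \<Rightarrow> real"
    and K :: "(real ^ 'd) set set"
    and iV iW :: "(real ^ 'd) aefun \<Rightarrow> (real ^ 'd) aefun"
    and u uh zh :: "(real ^ 'd) aefun"
    and \<Xi> \<delta>\<^sub>l :: "real \<Rightarrow> real"
    and \<sigma> h s t C\<^sub>W \<epsilon>\<^sub>0 \<eta> :: real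
  assumes domain: "convex_polyhedral_domain \<Omega>"
    and spaces: "normed_function_space \<Omega> V normV" "normed_function_space \<Omega> W normW"
    and a: "bilinear_form_on V W a"
    and l: "linear_form_on W l"
    and Xi: "\<And>x. x > 0 \<Longrightarrow> \<Xi> x \<ge> 0" "continuous_on {0<..} \<Xi>" "mono_on {0<..} \<Xi>"
      "(\<Xi> \<longlongrightarrow> 0) (at_right 0)" "\<Xi> 0 = 0"
    and mesh: "simplicial_mesh \<Omega> K" "\<sigma> > 0" "shape_regular \<sigma> K"
    and h: "h = mesh_size K"
    and Vh: "Vh = V \<inter> P1_space \<Omega> K"
    and Wh: "Wh = W \<inter> P1_space \<Omega> K"
    and s: "s \<ge> 1"
    and interpolation: "iV \<in> V \<rightarrow> Vh" "iW \<in> W \<rightarrow> Wh"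
    and star_norms: "norm_on V starV" "norm_on W starW"
    and delta: "\<delta>\<^sub>l h \<ge> 0"
    and exact: "u \<in> V \<inter> sobolev \<Omega> s" "\<And>w. w \<in> W \<Longrightarrow> a u w = l w"
    and exact_unique: "\<And>v. v \<in> V \<Longrightarrow> (\<And>w. w \<in> W \<Longrightarrow> a v w = l w) \<Longrightarrow> v = u"
    and discrete: "uh \<in> Vh" "zh \<in> Wh"
      "\<And>wh. wh \<in> Wh \<Longrightarrow> a uh wh - sW zh wh = l wh"
      "\<And>vh. vh \<in> Vh \<Longrightarrow> a vh zh + sV uh vh = sV u vh"
    and i: "sym_psd_form_on (sobolev \<Omega> s + Vh) sV" "sym_psd_form_on (sobolev \<Omega> s + Wh) sW"
      "seminorm_on (sobolev \<Omega> s + Vh) (form_seminorm sV)"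
      "seminorm_on (sobolev \<Omega> s + Wh) (form_seminorm sW)"
    and ii: "\<And>v wh. v \<in> V \<Longrightarrow> wh \<in> Wh \<Longrightarrow>
      a (v - iV v) wh \<le> starV (v - iV v) * form_seminorm sW wh"
    and iii: "\<And>w. w \<in> W \<Longrightarrow>
      a (u - uh) (w - iW w) \<le> \<delta>\<^sub>l h * normW w + starW (w - iW w) * form_seminorm sV (u - uh)"
    and iv: "t > 0" "Vsm \<subseteq> V \<inter> sobolev \<Omega> s" "\<And>v. v \<in> Vsm \<Longrightarrow> C\<^sub>V v > 0"
      "\<And>v. v \<in> Vsm \<Longrightarrow> form_seminorm sV (v - iV v) + starV (v - iV v) \<le> C\<^sub>V v * h powr t"
    and v: "C\<^sub>W > 0"
      "\<And>w. w \<in> W \<Longrightarrow> starW (w - iW w) + form_seminorm sW (iW w) \<le> C\<^sub>W * normW w"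
    and continuous_dependence: "\<epsilon>\<^sub>0 > 0"
      "\<And>\<epsilon> l' u'. 0 < \<epsilon> \<Longrightarrow> \<epsilon> < \<epsilon>\<^sub>0 \<Longrightarrow> linear_form_on W l' \<Longrightarrow> dual_norm W normW l' \<le> ennreal \<epsilon> \<Longrightarrow>
         u' \<in> V \<Longrightarrow> (\<And>w. w \<in> W \<Longrightarrow> a u' w = l' w) \<Longrightarrow> \<bar>j u'\<bar> \<le> \<Xi> \<epsilon>"
    and eta: "\<eta> = estimator (\<delta>\<^sub>l h) C\<^sub>W sV sW u uh zh"
  shows "(\<eta> < \<epsilon>\<^sub>0 \<longrightarrow> \<bar>j (u - uh)\<bar> \<le> \<Xi> \<eta>) \<and>
    (u \<in> Vsm \<longrightarrow> \<eta> \<le> \<delta>\<^sub>l h + (1 + sqrt 2) * C\<^sub>W * C\<^sub>V u * h powr t)"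
proof (intro conjI impI)
  define SV where "SV = sobolev \<Omega> s + Vh"
  define SW where "SW = sobolev \<Omega> s + Wh"
  define e where "e = u - uh"
  let ?NV = "form_seminorm sV" and ?NW = "form_seminorm sW"
  note i = i[folded SV_def SW_def]
  have subV: "subspace V" and subW: "subspace W" and normW: "norm_on W normW"
    using spaces by (auto simp: normed_function_space_def)
  have subVh: "subspace Vh" and subWh: "subspace Wh"
    using subV subW by (auto simp: Vh Wh intro: subspace_inter subspace_P1_space)
  have VhV: "Vh \<subseteq> V" and WhW: "Wh \<subseteq> W"
    by (auto simp: Vh Wh)
  have VhSV: "v \<in> SV" if "v \<in> Vh" for v
    using set_plus_intro[OF zero_in_sobolev that] by (simp add: SV_def)
  have WhSW: "w \<in> SW" if "w \<in> Wh" for w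
    using set_plus_intro[OF zero_in_sobolev that] by (simp add: SW_def)
  \<comment> \<open>Here \<open>u\<close> supplies the Sobolev summand and \<open>- v\<close> the
    discrete one. Used with \<open>v\<close> equal to \<open>uh\<close>, \<open>iV u\<close> and
    \<open>iV u + \<xi>\<close>.\<close>
  have u_diff: "u - v \<in> SV" if "v \<in> Vh" for v
    using set_plus_intro[OF IntD2[OF exact(1)] subspace_neg[OF subVh that]] by (simp add: SV_def)
  have eV: "e \<in> V" and eSV: "e \<in> SV"
    using exact(1) discrete(1) VhV u_diff subV by (auto simp: e_def subspace_diff)
  note NV = seminorm_onD[OF i(3)] and NW = seminorm_onD[OF i(4)]
  have bW: "bilinear_form_on SW SW sW" and bV: "bilinear_form_on SV SV sV"
    and symV: "\<And>v w. v \<in> SV \<Longrightarrow> w \<in> SV \<Longrightarrow> sV v w = sV w v"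
    using i(1,2) by (auto simp: sym_psd_form_on_def)

  \<comment> \<open>Perturbed Galerkin orthogonality: as \<open>Wh \<subseteq> W\<close>, the exact
    equation can be tested with \<open>w\<close> and the discrete one subtracted.\<close>
  have error_eq: "a e w = - sW zh w" if "w \<in> Wh" for w
  proof -
    have "a e w = a u w - a uh w"
      unfolding e_def using that WhW VhV exact(1) discrete(1)
      by (intro linear_form_on_diff[OF bilinear_form_onD(2)[OF a] subV]) auto
    then show ?thesis
      using discrete(3)[OF that] exact(2)[of w] that WhW by auto
  qed

  have eta': "\<eta> = \<delta>\<^sub>l h + C\<^sub>W * (?NV e + ?NW zh)"
    by (simp add: eta estimator_def e_def)
  have zh: "zh \<in> SW"
    by (rule WhSW[OF discrete(2)])
  have eta_nonneg: "0 \<le> \<eta>"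
    using delta v(1) NV(1)[OF eSV] NW(1)[OF zh] by (simp add: eta')

  \<comment> \<open>The residual of the error equation\<close>
  have residual: "a e w \<le> \<eta> * normW w" if w: "w \<in> W" for w
  proof -
    have iWw: "iW w \<in> Wh" and iWw': "iW w \<in> W"
      using interpolation(2) w WhW by auto
    have wd: "w - iW w \<in> W"
      using subW w iWw' by (rule subspace_diff)
    have star: "0 \<le> starW (w - iW w)"
      using star_norms(2) wd by (auto simp: norm_on_def seminorm_on_def)
    have nw: "0 \<le> ?NW (iW w)"
      by (rule NW(1)[OF WhSW[OF iWw]])
    have "a e w = a e (w - iW w) + a e (iW w)"
      using linear_form_on_add[OF bilinear_form_onD(1)[OF a eV] wd iWw'] by simp
    \<comment> \<open>The sign moves into the argument because Cauchy-Schwarz is available as an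
      upper bound only; the seminorm does not see it.\<close>
    also have "a e (iW w) = sW zh (- iW w)"
      using error_eq[OF iWw] linear_form_on_uminus[OF bilinear_form_onD(1)[OF bW zh] WhSW[OF iWw]]
      by simp
    also have "\<dots> \<le> ?NW zh * ?NW (iW w)"
    proof -
      have neg: "- iW w \<in> Wh" and sum: "zh + - iW w \<in> Wh"
        using subWh iWw discrete(2) by (auto simp: subspace_neg subspace_diff)
      show ?thesis
        using sym_psd_form_on_Cauchy_Schwarz[OF i(2,4) zh WhSW[OF neg] WhSW[OF sum]]
          seminorm_on_uminus[OF i(4) WhSW[OF iWw]] by simp
    qed
    \<comment> \<open>Both summands on the left of (v) are nonnegative, so each alone is at most
      \<open>C\<^sub>W * normW w\<close>; the other one is used below.\<close>
    also have "\<dots> \<le> ?NW zh * (C\<^sub>W * normW w)"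
      using v(2)[OF w] star NW(1)[OF zh] by (intro mult_left_mono) auto
    finally have "a e w \<le> a e (w - iW w) + ?NW zh * (C\<^sub>W * normW w)" by simp
    moreover have "a e (w - iW w) \<le> \<delta>\<^sub>l h * normW w + starW (w - iW w) * ?NV e"
      using iii[OF w] by (simp add: e_def)
    moreover have "starW (w - iW w) * ?NV e \<le> C\<^sub>W * normW w * ?NV e"
      using v(2)[OF w] nw NV(1)[OF eSV] by (intro mult_right_mono) auto
    ultimately show ?thesis
      by (simp add: eta' algebra_simps)
  qed

  \<comment> \<open>Continuous dependence applied to the error\<close>
  have lin: "linear_form_on W (a e)"
    by (rule bilinear_form_onD(1)[OF a eV])
  \<comment> \<open>Allowing every \<open>\<epsilon>\<close> above \<open>\<eta>\<close> leaves room
    to let \<open>\<epsilon>\<close> tend to 0 when \<open>\<eta> = 0\<close>.\<close>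
  have j_le: "\<bar>j e\<bar> \<le> \<Xi> \<epsilon>" if "0 < \<epsilon>" "\<epsilon> < \<epsilon>\<^sub>0" "\<eta> \<le> \<epsilon>" for \<epsilon>
  proof -
    have "dual_norm W normW (a e) \<le> ennreal \<eta>"
      by (rule dual_norm_le[OF lin normW subW eta_nonneg residual])
    also have "\<dots> \<le> ennreal \<epsilon>"
      using that by (intro ennreal_leI)
    finally show ?thesis
      using continuous_dependence(2)[OF that(1,2) lin _ eV] by simp
  qed

  show "\<bar>j (u - uh)\<bar> \<le> \<Xi> \<eta>" if "\<eta> < \<epsilon>\<^sub>0"
  proof (cases "\<eta> = 0")
    case False
    then show ?thesis
      using j_le[of \<eta>] eta_nonneg that by (simp add: e_def)
  next
    case True
    \<comment> \<open>Continuous dependence requires \<open>0 < \<epsilon>\<close>, so this case is a limit.\<close>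
    have "\<forall>\<^sub>F \<epsilon> in at_right 0. \<bar>j e\<bar> \<le> \<Xi> \<epsilon>"
      using eventually_at_right_less[of "0::real"] eventually_at_right_real[OF continuous_dependence(1)]
      by eventually_elim (use j_le True in auto)
    \<comment> \<open>The constant \<open>\<bar>j e\<bar>\<close> lies below \<open>\<Xi>\<close>
      near 0, hence below its right limit 0, which is also the conventional value
      \<open>\<Xi> 0\<close>.\<close>
    then have "\<bar>j e\<bar> \<le> 0"
      using Xi(4) by (intro tendsto_lowerbound) auto
    then show ?thesis
      using Xi(5) True by (simp add: e_def)
  qed

  \<comment> \<open>A priori bound for the estimator\<close>
  show "\<eta> \<le> \<delta>\<^sub>l h + (1 + sqrt 2) * C\<^sub>W * C\<^sub>V u * h powr t" if sm: "u \<in> Vsm"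
  proof -
    define r where "r = u - iV u"
    define \<xi> where "\<xi> = iV u - uh"
    have iVu: "iV u \<in> Vh"
      using interpolation(1) exact(1) by auto
    have xi: "\<xi> \<in> Vh"
      unfolding \<xi>_def using subVh iVu discrete(1) by (rule subspace_diff)
    have xiSV: "\<xi> \<in> SV" and xiV: "\<xi> \<in> V"
      using xi VhV by (auto intro: VhSV)
    have rSV: "r \<in> SV"
      unfolding r_def by (rule u_diff[OF iVu])
    have rV: "r \<in> V"
      unfolding r_def using subV exact(1) iVu VhV by (auto intro: subspace_diff)
    have e_split: "e = r + \<xi>"
      by (simp add: e_def r_def \<xi>_def)
    have zhW: "zh \<in> W" and neg_zh: "- zh \<in> Wh"
      using discrete(2) WhW subWh by (auto simp: subspace_neg)
    have p: "0 \<le> starV r"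
      using star_norms(1) rV by (auto simp: norm_on_def seminorm_on_def)

    have "sW zh zh = - (a r zh + a \<xi> zh)"
      using error_eq[OF discrete(2)]
        linear_form_on_add[OF bilinear_form_onD(2)[OF a zhW] rV xiV]
      by (simp add: e_split)
    \<comment> \<open>The second discrete equation says
      \<open>a \<xi> zh = sV (u - uh) \<xi>\<close>, since its right-hand side carries the exact
      \<open>u\<close>; then \<open>e = r + \<xi>\<close> is inserted.\<close>
    moreover have "a \<xi> zh = sV r \<xi> + sV \<xi> \<xi>"
    proof -
      have uh: "uh \<in> SV" by (rule VhSV[OF discrete(1)])
      have "sV u \<xi> = sV e \<xi> + sV uh \<xi>"
        using linear_form_on_add[OF bilinear_form_onD(2)[OF bV xiSV] eSV uh]
        by (simp add: e_def)
      moreover have "sV e \<xi> = sV r \<xi> + sV \<xi> \<xi>"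
        using linear_form_on_add[OF bilinear_form_onD(2)[OF bV xiSV] rSV xiSV]
        by (simp add: e_split)
      ultimately show ?thesis
        using discrete(4)[OF xi] by simp
    qed
    \<comment> \<open>Signs again go into the arguments, so that the one-sided bound (ii) and
      Cauchy-Schwarz apply.\<close>
    ultimately have energy: "(?NV \<xi>)\<^sup>2 + (?NW zh)\<^sup>2 = a r (- zh) + sV r (- \<xi>)"
      using form_seminorm_square[OF i(1) xiSV] form_seminorm_square[OF i(2) zh]
        linear_form_on_uminus[OF bilinear_form_onD(1)[OF a rV] zhW]
        linear_form_on_uminus[OF bilinear_form_onD(1)[OF bV rSV] xiSV]
      by simp
    have "a r (- zh) \<le> starV r * ?NW zh"
      using ii[of u "- zh"] exact(1) neg_zh seminorm_on_uminus[OF i(4) zh]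
      by (simp add: r_def)
    moreover have "sV r (- \<xi>) \<le> ?NV r * ?NV \<xi>"
    proof -
      have neg: "- \<xi> \<in> SV"
        using subVh xi by (intro VhSV subspace_neg)
      \<comment> \<open>Cauchy-Schwarz for \<open>r\<close> and \<open>- \<xi>\<close> asks for
        \<open>r - \<xi>\<close> in \<open>SV\<close>; this is \<open>u\<close> minus the discrete
        function \<open>iV u + \<xi>\<close>.\<close>
      have "iV u + \<xi> \<in> Vh"
        using subVh iVu xi by (rule subspace_add)
      from u_diff[OF this] have "r + - \<xi> \<in> SV"
        by (simp add: r_def algebra_simps)
      then show ?thesis
        using sym_psd_form_on_Cauchy_Schwarz[OF i(1,3) rSV neg] seminorm_on_uminus[OF i(3) xiSV]
        by simp
    qed
    \<comment> \<open>The lemma is applied with \<open>p = ?NV r\<close>,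
      \<open>q = starV r\<close>, \<open>x = ?NV \<xi>\<close> and
      \<open>y = ?NW zh\<close>.\<close>
    ultimately have "?NV \<xi> + ?NW zh \<le> sqrt 2 * (?NV r + starV r)"
      using energy p NV(1)[OF rSV] NV(1)[OF xiSV] NW(1)[OF zh]
      by (intro sum_le_sqrt2_of_squares_le) auto
    moreover have "?NV e \<le> ?NV r + ?NV \<xi>"
      unfolding e_split by (rule NV(2)[OF rSV xiSV])
    \<comment> \<open>Since \<open>starV r\<close> is nonnegative, the extra \<open>?NV r\<close> is
      at most \<open>?NV r + starV r\<close>.\<close>
    ultimately have "?NV e + ?NW zh \<le> (1 + sqrt 2) * (?NV r + starV r)"
      using p by (simp add: algebra_simps)
    also have "\<dots> \<le> (1 + sqrt 2) * (C\<^sub>V u * h powr t)"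
      using iv(4)[OF sm] by (intro mult_left_mono) (auto simp: r_def add_nonneg_nonneg)
    finally have "C\<^sub>W * (?NV e + ?NW zh) \<le> C\<^sub>W * ((1 + sqrt 2) * (C\<^sub>V u * h powr t))"
      using v(1) by (intro mult_left_mono) auto
    then show ?thesis
      by (simp add: eta' algebra_simps)
  qed
qed

end
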